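(* Let $c\in(0,1)$ and consider the following optimization problem over $h\in L^2((0,1)^2)$: $$\max\ \int_0^1\!\!\int_0^1 2(1-t)^2\,h(t,v)\,\mathrm dt\,\mathrm dv$$ subject to $$6\int_0^1\!\!\int_0^1 h^2(t,v)\,\mathrm dt\,\mathrm dv-2\le c,\qquad \int_0^1 h(t,v)\,\mathrm dt=v\ \text{ for a.e. }v\in(0,1),\qquad 0\le h\le 1\ \text{ a.e.}$$ Then there is a unique $b_c>0$ with $\xi(C_{b_c})=c$, and the optimizer of this problem is uniquely given (as an element of $L^2((0,1)^2)$) by $h_{b_c}$.
   Context: Write $\operatorname{clamp}(y,\alpha,\beta):=\min\{\max\{y,\alpha\},\beta\}$ for $\alpha<\beta$. For $b>0$ and $v\in[0,1]$ let $q(v)=q_b(v)\in[-1/b,1]$ be the unique number with $\int_0^1\operatorname{clamp}\bigl(b((1-t)^2-q(v)),0,1\bigr)\,\mathrm dt=v$ (existence and uniqueness hold). Put $$h_b(t,v):=\operatorname{clamp}\bigl(b((1-t)^2-q(v)),0,1\bigr),\qquad C_b(u,v):=\int_0^u h_b(t,v)\,\mathrm dt,\qquad t,u,v\in[0,1].$$ Each $C_b$ is a bivariate copula (a distribution function on $[0,1]^2$ with uniform marginals), with first partial derivative $\partial_1C_b=h_b$. Chatterjee's rank correlation of a copula $C$ is $$\xi(C):=6\int_0^1\!\!\int_0^1(\partial_1C(t,v))^2\,\mathrm dt\,\mathrm dv-2.$$ *)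

theory Defs
  imports "HOL-Analysis.Analysis"
begin

text \<open>The \<open>clamp\<close> of HOL-Analysis is a different, componentwise operation with another argument
  order, hence a separate name.\<close>

definition clamp_real :: "real \<Rightarrow> real \<Rightarrow> real \<Rightarrow> real" where
  "clamp_real y \<alpha> \<beta> = min (max y \<alpha>) \<beta>"

text \<open>Meaningful for \<open>b > 0\<close> and \<open>0 \<le> v \<le> 1\<close>, where existence and uniqueness hold.\<close>

definition q_fun :: "real \<Rightarrow> real \<Rightarrow> real" where
  "q_fun b v = (THE q. q \<in> {-1/b..1} \<and>
      (LINT t:{0..1}|lebesgue. clamp_real (b * ((1 - t)\<^sup>2 - q)) 0 1) = v)"

definition h_fun :: "real \<Rightarrow> real \<Rightarrow> real \<Rightarrow> real" where
  "h_fun b t v = clamp_real (b * ((1 - t)\<^sup>2 - q_fun b v)) 0 1"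

definition C_fun :: "real \<Rightarrow> real \<Rightarrow> real \<Rightarrow> real" where
  "C_fun b u v = (LINT t:{0..u}|lebesgue. h_fun b t v)"

text \<open>Chatterjee's rank correlation of a copula \<open>C\<close>. The partial derivative of a copula in its
  first argument exists almost everywhere; elsewhere \<open>deriv\<close> has an unspecified value, which does
  not affect the Lebesgue integral.\<close>

definition chatterjee_xi :: "(real \<Rightarrow> real \<Rightarrow> real) \<Rightarrow> real" where
  "chatterjee_xi C =
     6 * (LINT v:{0..1}|lebesgue. LINT t:{0..1}|lebesgue. (deriv (\<lambda>s. C s v) t)\<^sup>2) - 2"

abbreviation unit_square :: "(real \<times> real) set" where
  "unit_square \<equiv> {0<..<1} \<times> {0<..<1}"

text \<open>Representatives of the elements of \<open>L\<^sup>2((0,1)\<^sup>2)\<close>; values outside the open unit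
  square are irrelevant, and equality in \<open>L\<^sup>2\<close> is equality almost everywhere on the square.\<close>

definition L2_square :: "(real \<Rightarrow> real \<Rightarrow> real) set" where
  "L2_square = {h. (\<lambda>(t, v). h t v) \<in> borel_measurable (lebesgue_on unit_square) \<and>
                   integrable (lebesgue_on unit_square) (\<lambda>(t, v). (h t v)\<^sup>2)}"

definition L2_eq :: "(real \<Rightarrow> real \<Rightarrow> real) \<Rightarrow> (real \<Rightarrow> real \<Rightarrow> real) \<Rightarrow> bool" where
  "L2_eq g h \<longleftrightarrow> (AE (t, v) in lebesgue_on unit_square. g t v = h t v)"

definition objective :: "(real \<Rightarrow> real \<Rightarrow> real) \<Rightarrow> real" where
  "objective h = (LINT v:{0<..<1}|lebesgue. LINT t:{0<..<1}|lebesgue. 2 * (1 - t)\<^sup>2 * h t v)"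

definition feasible :: "real \<Rightarrow> (real \<Rightarrow> real \<Rightarrow> real) \<Rightarrow> bool" where
  "feasible c h \<longleftrightarrow> h \<in> L2_square \<and>
     6 * (LINT v:{0<..<1}|lebesgue. LINT t:{0<..<1}|lebesgue. (h t v)\<^sup>2) - 2 \<le> c \<and>
     (AE v in lebesgue_on {0<..<1}. (LINT t:{0<..<1}|lebesgue. h t v) = v) \<and>
     (AE (t, v) in lebesgue_on unit_square. 0 \<le> h t v \<and> h t v \<le> 1)"

end

theory Submission
  imports Defs
begin

text \<open>Write \<open>x = (1 - t)\<^sup>2\<close>. For fixed \<open>v\<close> the clamped parabola \<open>k = clamp (b (x - q), 0, 1)\<close> maximizes the
  strictly concave function \<open>y \<mapsto> 2 (x - q) y - y\<^sup>2 / b\<close> over \<open>[0,1]\<close> pointwise, with a gap of at least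
  \<open>(k - y)\<^sup>2 / b\<close>. Integrating over the square, the multiplier \<open>q = q(v)\<close> disappears because of the
  marginal constraint, and \<open>h\<^sub>b\<close> turns out to be the unique optimizer for the bound \<open>c = \<xi>(C\<^sub>b)\<close>.
  Applying the same inequality to \<open>h\<^sub>b\<close> and \<open>h\<^sub>b\<^sub>'\<close> in both orders and adding gives
  \<open>(b + b') \<parallel>h\<^sub>b - h\<^sub>b\<^sub>'\<parallel>\<^sup>2 \<le> (b' - b) (\<parallel>h\<^sub>b\<^sub>'\<parallel>\<^sup>2 - \<parallel>h\<^sub>b\<parallel>\<^sup>2)\<close>, whence
  \<open>b \<mapsto> \<xi>(C\<^sub>b)\<close> is injective and locally Lipschitz without any formula for \<open>q\<close>. Since
  \<open>1/2 - 1 / sqrt b \<le> \<parallel>h\<^sub>b\<parallel>\<^sup>2 \<le> 1/3 + b/2\<close>, the intermediate value theorem yields every \<open>c\<close> in \<open>(0,1)\<close>.\<close>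

section \<open>The uniform distribution on the unit interval and square\<close>

text \<open>Taken on the Borel sets so that Fubini's theorem applies to \<open>unif2\<close>; the
  product of two completed measures would not be Lebesgue measure on the plane.\<close>

definition unif :: "real measure" where
  "unif = density lborel (indicator {0<..<1})"

abbreviation unif2 :: "(real \<times> real) measure" where
  "unif2 \<equiv> unif \<Otimes>\<^sub>M unif"

lemma sets_unif [simp, measurable_cong]: "sets unif = sets borel"
  by (simp add: unif_def)

lemma space_unif [simp]: "space unif = UNIV"
  by (simp add: unif_def)

lemma emeasure_unif: "A \<in> sets borel \<Longrightarrow> emeasure unif A = emeasure lborel ({0<..<1} \<inter> A)"
  unfolding unif_def
  by (subst emeasure_density) (auto simp: indicator_inter_arith[symmetric] cong: nn_integral_cong)

interpretation unif: finite_measure unif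
  by standard (simp add: emeasure_unif)

lemma measure_unif_UNIV [simp]: "measure unif UNIV = 1"
  by (simp add: measure_def emeasure_unif)

interpretation unif2: pair_sigma_finite unif unif ..

interpretation unif2: finite_measure unif2
  by (rule finite_measure_pair_measure) unfold_locales

lemma measure_unif2_UNIV [simp]: "measure unif2 UNIV = 1"
  using unif.emeasure_pair_measure_Times[of UNIV unif UNIV]
  by (simp add: measure_def emeasure_unif)

lemma AE_unif_iff: "(AE x in unif. P x) \<longleftrightarrow> (AE x in lborel. x \<in> {0<..<1} \<longrightarrow> P x)"
  unfolding unif_def by (subst AE_density) (auto simp: indicator_def)

lemma AE_unif_mem: "AE x in unif. x \<in> {0<..<1}"
  by (simp add: AE_unif_iff)

lemma integral_unif:
  fixes f :: "real \<Rightarrow> real"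
  assumes "f \<in> borel_measurable borel"
  shows "integral\<^sup>L unif f = (LINT x:{0<..<1}|lborel. f x)"
proof -
  have *: "unif = density lborel (\<lambda>x. ennreal (indicator {0<..<1} x))"
    by (simp add: unif_def ennreal_indicator)
  show ?thesis
    unfolding * set_lebesgue_integral_def using assms by (subst integral_density) auto
qed

lemma unif2_density: "unif2 = density lborel (indicator ({0<..<1} \<times> {0<..<1}))"
proof -
  have "unif2 = density (lborel \<Otimes>\<^sub>M lborel) (\<lambda>(x,y). indicator {0<..<1} x * indicator {0<..<1} y)"
    unfolding unif_def
  proof (rule pair_measure_density)
    show "sigma_finite_measure (density lborel (indicator {0<..<1::real}))"
      using unif.sigma_finite_measure_axioms by (simp add: unif_def)
  qed (auto intro: sigma_finite_lborel)
  also have "(\<lambda>(x,y). indicator {0<..<1} x * indicator {0<..<1} y :: ennreal) = indicator ({0<..<1::real} \<times> {0<..<1::real})"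
    by (auto simp: indicator_def fun_eq_iff)
  finally show ?thesis by (simp add: lborel_prod)
qed

lemma unit_square_borel [measurable]: "unit_square \<in> sets borel"
  by (intro borel_open open_Times) auto

text \<open>Completing a measure leaves almost-everywhere statements unchanged, so the Borel product
  \<open>unif2\<close> can stand in for Lebesgue measure on the square.\<close>

lemma AE_unif2_iff: "(AE z in unif2. P z) \<longleftrightarrow> (AE z in lebesgue_on unit_square. P z)"
proof -
  have "(AE z in unif2. P z) \<longleftrightarrow> (AE z in lborel. z \<in> unit_square \<longrightarrow> P z)"
    unfolding unif2_density by (subst AE_density) (auto simp: indicator_def)
  also have "\<dots> \<longleftrightarrow> (AE z in lebesgue_on unit_square. P z)"
    by (subst AE_restrict_space_iff) (auto simp: AE_completion_iff)
  finally show ?thesis .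
qed

lemma AE_unif2_mem: "AE (t, v) in unif2. t \<in> {0<..<1} \<and> v \<in> {0<..<1}"
  unfolding AE_unif2_iff by (auto simp: AE_restrict_space_iff)

text \<open>\<open>P\<close> may be non-measurable; it is replaced by the complement of a measurable
  null set \<open>N\<close>, for which the quantifiers over \<open>t\<close> and \<open>v\<close>
  commute.\<close>

lemma AE_unif2_slices:
  assumes "AE z in unif2. P z"
  shows "AE v in unif. AE t in unif. P (t, v)"
proof -
  obtain N where N: "N \<in> null_sets unif2" "\<And>z. z \<notin> N \<Longrightarrow> P z"
    using assms by (auto elim!: AE_E3 simp: space_pair_measure)
  have meas: "{z \<in> space unif2. z \<notin> N} \<in> sets unif2"
    using N by (intro sets.sets_Collect_neg) (auto simp: space_pair_measure)
  have "AE t in unif. AE v in unif. (t, v) \<notin> N"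
    using AE_not_in[OF N(1)] by (intro unif2.AE_pair) auto
  then have "AE v in unif. AE t in unif. (t, v) \<notin> N"
    using meas by (subst (asm) unif2.AE_commute) auto
  then show ?thesis
    by eventually_elim (auto elim!: eventually_mono intro: N)
qed

lemma integrable_unif2_bounded:
  fixes f :: "real \<times> real \<Rightarrow> real"
  assumes "f \<in> borel_measurable (borel \<Otimes>\<^sub>M borel)" "AE z in unif2. \<bar>f z\<bar> \<le> B"
  shows "integrable unif2 f"
  using assms by (intro unif2.integrable_const_bound[of _ B]) auto

text \<open>No measurability of \<open>f\<close> is needed: the Lebesgue measure is complete.\<close>

lemma lebesgue_integral_unit_interval:
  fixes f g :: "real \<Rightarrow> real"
  assumes g: "g \<in> borel_measurable borel" and fg: "AE x in unif. f x = g x"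
    and A: "A = {0<..<1} \<or> A = {0..1}"
  shows "(LINT x:A|lebesgue. f x) = integral\<^sup>L unif g"
proof -
  have [measurable]: "g \<in> borel_measurable borel" by (fact g)
  let ?I = "{0<..<1::real}"
  \<comment> \<open>The endpoints are null, so the open interval of \<open>feasible\<close> and the
    closed one of \<open>q_fun\<close> and \<open>chatterjee_xi\<close> give the same
    integral.\<close>
  have "AE x in lborel. x \<noteq> (0::real)" "AE x in lborel. x \<noteq> (1::real)"
    by (rule AE_lborel_singleton)+
  then have "AE x in lborel. indicator ?I x *\<^sub>R g x = indicator A x *\<^sub>R f x"
    using fg[unfolded AE_unif_iff] by eventually_elim (use A in \<open>auto simp: indicator_def\<close>)
  then have ae: "AE x in lebesgue. indicator ?I x *\<^sub>R g x = indicator A x *\<^sub>R f x"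
    by (rule AE_completion)
  have m: "(\<lambda>x. indicator ?I x *\<^sub>R g x) \<in> borel_measurable lebesgue"
    by (rule measurable_completion) measurable
  have "(LINT x:A|lebesgue. f x) = (LINT x|lebesgue. indicator ?I x *\<^sub>R g x)"
    unfolding set_lebesgue_integral_def
    using ae by (intro integral_cong_AE borel_measurable_AE[OF m ae] m) (auto simp: eq_commute)
  also have "\<dots> = integral\<^sup>L unif g"
    by (simp add: integral_completion integral_unif set_lebesgue_integral_def)
  finally show ?thesis .
qed

text \<open>Almost every slice of \<open>f\<close> agrees almost everywhere with that of
  \<open>g\<close>, and Fubini applies to \<open>g\<close>. This turns the iterated integrals of the
  problem into integrals over \<open>unif2\<close>.\<close>

lemma lebesgue_iterated_unit_square:
  fixes f :: "real \<Rightarrow> real \<Rightarrow> real" and g :: "real \<times> real \<Rightarrow> real"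
  assumes g: "integrable unif2 g" and fg: "AE (t, v) in unif2. f t v = g (t, v)"
    and A: "A = {0<..<1} \<or> A = {0..1}"
  shows "AE v in unif. (LINT t:A|lebesgue. f t v) = (\<integral>t. g (t, v) \<partial>unif)"
    and "(LINT v:A|lebesgue. LINT t:A|lebesgue. f t v) = integral\<^sup>L unif2 g"
proof -
  have [measurable]: "g \<in> borel_measurable (borel \<Otimes>\<^sub>M borel)"
    using borel_measurable_integrable[OF g] by (simp cong: measurable_cong_sets)
  have "AE v in unif. AE t in unif. f t v = g (t, v)"
    using AE_unif2_slices[OF fg] by simp
  then show *: "AE v in unif. (LINT t:A|lebesgue. f t v) = (\<integral>t. g (t, v) \<partial>unif)"
    by eventually_elim (rule lebesgue_integral_unit_interval[OF _ _ A]; simp)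
  have "(LINT v:A|lebesgue. LINT t:A|lebesgue. f t v) = (\<integral>v. \<integral>t. g (t, v) \<partial>unif \<partial>unif)"
    by (rule lebesgue_integral_unit_interval[OF _ * A]) measurable
  also have "\<dots> = integral\<^sup>L unif2 g"
    using unif2.integral_snd[of "\<lambda>t v. g (t, v)"] g by simp
  finally show "(LINT v:A|lebesgue. LINT t:A|lebesgue. f t v) = integral\<^sup>L unif2 g" .
qed

section \<open>Clamped parabolas\<close>

text \<open>\<open>h_fun\<close> with a free threshold \<open>q\<close>, to be studied before
  \<open>q_fun\<close> is known to be well defined.\<close>

definition ramp :: "real \<Rightarrow> real \<Rightarrow> real \<Rightarrow> real" where
  "ramp b q t = clamp_real (b * ((1 - t)\<^sup>2 - q)) 0 1"

lemma ramp_nonneg: "0 \<le> ramp b q t" and ramp_le_1: "ramp b q t \<le> 1"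
  by (auto simp: ramp_def clamp_real_def)

lemma abs_ramp_le_1: "\<bar>ramp b q t\<bar> \<le> 1"
  using ramp_nonneg[of b q t] ramp_le_1[of b q t] by simp

lemma continuous_on_ramp [continuous_intros]: "continuous_on A (ramp b q)"
  unfolding ramp_def clamp_real_def by (intro continuous_intros)

lemma ramp_measurable [measurable]: "ramp b q \<in> borel_measurable borel"
  by (intro borel_measurable_continuous_onI continuous_intros)

lemma integrable_ramp: "integrable unif (ramp b q)"
  by (rule unif.integrable_const_bound[of _ 1]) (auto simp: abs_ramp_le_1)

lemma ramp_lipschitz:
  assumes "b > 0"
  shows "\<bar>ramp b q t - ramp b q' t\<bar> \<le> b * \<bar>q - q'\<bar>"
proof -
  have *: "\<bar>clamp_real x 0 1 - clamp_real y 0 1\<bar> \<le> \<bar>x - y\<bar>" for x y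
    by (auto simp: clamp_real_def)
  have "\<bar>ramp b q t - ramp b q' t\<bar> \<le> \<bar>b * ((1 - t)\<^sup>2 - q) - b * ((1 - t)\<^sup>2 - q')\<bar>"
    unfolding ramp_def by (rule *)
  also have "b * ((1 - t)\<^sup>2 - q) - b * ((1 - t)\<^sup>2 - q') = b * (q' - q)"
    by (simp add: algebra_simps)
  finally show ?thesis using assms by (simp add: abs_mult abs_minus_commute)
qed

lemma ramp_antimono:
  assumes "b > 0" "q \<le> q'"
  shows "ramp b q' t \<le> ramp b q t"
proof -
  have "b * ((1 - t)\<^sup>2 - q') \<le> b * ((1 - t)\<^sup>2 - q)"
    using assms by simp
  then show ?thesis by (auto simp: ramp_def clamp_real_def)
qed

text \<open>On \<open>[0,1]\<close> the concave function \<open>y \<mapsto> 2 (x - q) y - y\<^sup>2 / b\<close>, where \<open>x = (1 - t)\<^sup>2\<close>, is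
  maximal at the point of \<open>[0,1]\<close> closest to its vertex \<open>b (x - q)\<close>.\<close>

lemma ramp_variational:
  assumes "b > 0" "0 \<le> y" "y \<le> 1"
  shows "2 * ((1 - t)\<^sup>2 - q) * y - y\<^sup>2 / b + (ramp b q t - y)\<^sup>2 / b
         \<le> 2 * ((1 - t)\<^sup>2 - q) * ramp b q t - (ramp b q t)\<^sup>2 / b"
proof -
  define z where "z = b * ((1 - t)\<^sup>2 - q)"
  define k where "k = ramp b q t"
  have z: "(1 - t)\<^sup>2 - q = z / b" using assms by (simp add: z_def)
  have "(k < z \<and> k = 1) \<or> (k > z \<and> k = 0) \<or> k = z"
    unfolding k_def ramp_def z_def[symmetric] clamp_real_def by auto
  \<comment> \<open>As \<open>k\<close> is the projection of \<open>z\<close> onto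
    \<open>[0,1]\<close>, the factors never have opposite signs. Twice this product is the
    difference of the two sides of the next inequality.\<close>
  then have "(z - k) * (k - y) \<ge> 0"
    using assms by (auto intro: mult_nonneg_nonneg mult_nonpos_nonpos)
  then have "2 * z * y - y\<^sup>2 + (k - y)\<^sup>2 \<le> 2 * z * k - k\<^sup>2"
    by (simp add: algebra_simps power2_eq_square)
  then have "(2 * z * y - y\<^sup>2 + (k - y)\<^sup>2) / b \<le> (2 * z * k - k\<^sup>2) / b"
    using assms by (intro divide_right_mono) auto
  then show ?thesis
    unfolding k_def[symmetric] z by (simp add: add_divide_distrib diff_divide_distrib)
qed

text \<open>A mean strictly between 0 and 1 excludes the constants 0 and 1, and a continuous
  function taking both values on an interval also takes 1/2.\<close>

lemma ramp_interior:
  assumes "0 < integral\<^sup>L unif (ramp b q)" "integral\<^sup>L unif (ramp b q) < 1"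
  obtains t where "0 < t" "t < 1" "0 < ramp b q t" "ramp b q t < 1"
proof -
  have "\<exists>t\<in>{0<..<1}. 0 < ramp b q t \<and> ramp b q t < 1"
  proof (rule ccontr)
    assume "\<not> ?thesis"
    then have dich: "ramp b q t = 0 \<or> ramp b q t = 1" if "t \<in> {0<..<1}" for t
      using ramp_nonneg[of b q t] ramp_le_1[of b q t] that by force
    have 1: False if "\<And>t. t \<in> {0<..<1} \<Longrightarrow> ramp b q t = c" "c = 0 \<or> c = 1" for c
    proof -
      have "integral\<^sup>L unif (ramp b q) = (\<integral>t. c \<partial>unif)"
        by (intro integral_cong_AE eventually_mono[OF AE_unif_mem]) (auto simp: that(1))
      then show False using assms that(2) by auto
    qed
    have "\<exists>t\<in>{0<..<1}. ramp b q t = 0" "\<exists>t\<in>{0<..<1}. ramp b q t = 1"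
      using 1[of 0] 1[of 1] dich by blast+
    then have "0 \<in> ramp b q ` {0<..<1}" "1 \<in> ramp b q ` {0<..<1}"
      by (metis image_eqI)+
    moreover have "connected (ramp b q ` {0<..<1})"
      by (intro connected_continuous_image continuous_intros connected_Ioo)
    ultimately have "1/2 \<in> ramp b q ` {0<..<1}"
      using connectedD_interval[of "ramp b q ` {0<..<1}" 0 1 "1/2"] by simp
    then show False using dich by force
  qed
  then show ?thesis using that by auto
qed

text \<open>Continuous functions agree on a closed set, and a closed set containing almost all of an
  open interval contains all of it.\<close>

lemma ramp_AE_cong:
  assumes "AE t in unif. ramp b q t = ramp b' q' t" "t \<in> {0<..<1}"
  shows "ramp b q t = ramp b' q' t"
proof -
  have "AE t \<in> {0<..<1} in lebesgue. t \<in> {t. ramp b q t = ramp b' q' t}"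
    using assms(1) by (simp add: AE_unif_iff AE_completion_iff)
  moreover have "closed {t. ramp b q t = ramp b' q' t}"
    by (intro closed_Collect_eq continuous_intros)
  ultimately show ?thesis
    using mem_closed_if_AE_lebesgue_open[of "{0<..<1}" "{t. ramp b q t = ramp b' q' t}" t] assms(2)
    by auto
qed

text \<open>Where the first ramp lies strictly between 0 and 1, both are unclamped affine functions
  of \<open>(1 - t)\<^sup>2\<close>. Agreement at two points determines the slope \<open>b\<close>,
  then the threshold \<open>q\<close>.\<close>

lemma ramp_inj:
  assumes "0 < b" "0 < b'" and ae: "AE t in unif. ramp b q t = ramp b' q' t"
    and "0 < integral\<^sup>L unif (ramp b q)" "integral\<^sup>L unif (ramp b q) < 1"
  shows "b = b'" "q = q'"
proof -
  define W where "W = {t. 0 < t \<and> t < 1 \<and> 0 < ramp b q t \<and> ramp b q t < 1}"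
  have "open W"
    unfolding W_def by (intro open_Collect_conj open_Collect_less continuous_intros)
  moreover obtain t where t: "t \<in> W"
    using ramp_interior[OF assms(4,5)] unfolding W_def by auto
  ultimately obtain s where s: "s \<in> W" "s \<noteq> t"
    using not_open_singleton[of t] by (cases "W \<subseteq> {t}") (auto simp: subset_singleton_iff)
  have clamp: "x = y" if "clamp_real x 0 1 = clamp_real y 0 1" "0 < clamp_real x 0 1" "clamp_real x 0 1 < 1" for x y
    using that by (auto simp: clamp_real_def min_def max_def split: if_splits)
  have eq: "b * ((1 - r)\<^sup>2 - q) = b' * ((1 - r)\<^sup>2 - q')" if "r \<in> W" for r
    using ramp_AE_cong[OF ae, of r] that by - (rule clamp; auto simp: W_def ramp_def)
  have "(1 - s)\<^sup>2 \<noteq> (1 - t)\<^sup>2"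
    using s t by (auto simp: W_def power2_eq_iff)
  moreover have "(b - b') * ((1 - s)\<^sup>2 - (1 - t)\<^sup>2) = 0"
    using eq[OF s(1)] eq[OF t] by (simp add: algebra_simps)
  ultimately show "b = b'" by simp
  then show "q = q'" using eq[OF t] assms(1) by simp
qed

section \<open>Existence and uniqueness of the threshold \<open>q_fun b v\<close>\<close>

lemma integral_ramp_antimono:
  assumes "b > 0" "q \<le> q'"
  shows "integral\<^sup>L unif (ramp b q') \<le> integral\<^sup>L unif (ramp b q)"
  using assms by (intro integral_mono integrable_ramp ramp_antimono)

text \<open>The mean is Lipschitz in \<open>q\<close> and falls from 1 to 0 across
  \<open>{-1/b..1}\<close>, so it attains \<open>v\<close>. Ramps with ordered thresholds are
  ordered, so equal means force equality almost everywhere, and \<open>ramp_inj\<close>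
  applies.\<close>

lemma ex1_ramp_integral:
  assumes b: "b > 0" and v: "0 < v" "v < 1"
  shows "\<exists>!q. q \<in> {-1/b..1} \<and> integral\<^sup>L unif (ramp b q) = v"
proof -
  let ?F = "\<lambda>q. integral\<^sup>L unif (ramp b q)"
  have lip: "\<bar>?F q - ?F q'\<bar> \<le> b * \<bar>q - q'\<bar>" for q q'
  proof -
    have "\<bar>?F q - ?F q'\<bar> = \<bar>\<integral>t. ramp b q t - ramp b q' t \<partial>unif\<bar>"
      by (simp add: integrable_ramp)
    also have "\<dots> \<le> (\<integral>t. \<bar>ramp b q t - ramp b q' t\<bar> \<partial>unif)"
      by (rule integral_abs_bound)
    also have "\<dots> \<le> (\<integral>t. b * \<bar>q - q'\<bar> \<partial>unif)"
      by (intro integral_mono integrable_abs Bochner_Integration.integrable_diff integrable_ramp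
          ramp_lipschitz[OF b]) simp
    finally show ?thesis by simp
  qed
  have "b-lipschitz_on UNIV ?F"
    using b lip by (intro lipschitz_onI) (auto simp: dist_real_def)
  then have cont: "continuous_on UNIV ?F"
    by (rule lipschitz_on_continuous_on)
  have "ramp b (-1/b) = (\<lambda>_. 1)"
  proof
    fix t
    have "b * ((1 - t)\<^sup>2 - -1/b) = b * (1 - t)\<^sup>2 + 1" using b by (simp add: field_simps)
    then show "ramp b (-1/b) t = 1" using b by (simp add: ramp_def clamp_real_def)
  qed
  then have low: "?F (-1/b) = 1" by (simp only:) simp
  have "AE t in unif. ramp b 1 t = 0"
  proof (rule eventually_mono[OF AE_unif_mem])
    fix t :: real assume "t \<in> {0<..<1}"
    then have "(1 - t)\<^sup>2 \<le> 1" by (intro power_le_one) auto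
    then have "b * ((1 - t)\<^sup>2 - 1) \<le> 0" using b by (intro mult_nonneg_nonpos) auto
    then show "ramp b 1 t = 0" by (simp add: ramp_def clamp_real_def)
  qed
  then have high: "?F 1 = 0" by (rule integral_eq_zero_AE)
  have "-1/b \<le> 1" using b by (simp add: field_simps)
  then obtain q where q: "-1/b \<le> q" "q \<le> 1" "?F q = v"
    using IVT2'[of ?F 1 v "-1/b"] low high v continuous_on_subset[OF cont] by auto
  have le: "r = r'" if "r \<le> r'" "?F r = v" "?F r' = v" for r r'
  proof -
    have "(\<integral>t. ramp b r t - ramp b r' t \<partial>unif) = 0"
      using that by (simp add: integrable_ramp)
    then have "AE t in unif. ramp b r t - ramp b r' t = 0"
      by (subst (asm) integral_nonneg_eq_0_iff_AE)
         (auto intro: integrable_ramp ramp_antimono[OF b that(1)])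
    then show ?thesis
      using ramp_inj(2)[OF b b, of r r'] that v by simp
  qed
  show ?thesis
  proof (rule ex1I[of _ q])
    show "q \<in> {-1/b..1} \<and> ?F q = v" using q by auto
    show "r = q" if "r \<in> {-1/b..1} \<and> ?F r = v" for r
      using le[of r q] le[of q r] that q by linarith
  qed
qed

lemma integral_ramp_lebesgue:
  "(LINT t:{0..1}|lebesgue. ramp b q t) = integral\<^sup>L unif (ramp b q)"
  by (rule lebesgue_integral_unit_interval) auto

lemma
  assumes "b > 0" "0 < v" "v < 1"
  shows q_fun_mem: "q_fun b v \<in> {-1/b..1}"
    and integral_ramp_q_fun: "integral\<^sup>L unif (ramp b (q_fun b v)) = v"
proof -
  have "q_fun b v = (THE q. q \<in> {-1/b..1} \<and> integral\<^sup>L unif (ramp b q) = v)"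
    unfolding q_fun_def integral_ramp_lebesgue[symmetric] ramp_def ..
  then show "q_fun b v \<in> {-1/b..1}" "integral\<^sup>L unif (ramp b (q_fun b v)) = v"
    using theI'[OF ex1_ramp_integral[OF assms]] by auto
qed

text \<open>Raising the threshold never raises the mean, so a larger mean cannot belong to a larger
  threshold. The monotonicity yields measurability of \<open>q_fun\<close> in
  \<open>v\<close>.\<close>

lemma q_fun_antimono:
  assumes b: "b > 0" and v: "0 < v" "v \<le> v'" "v' < 1"
  shows "q_fun b v' \<le> q_fun b v"
proof (rule ccontr)
  assume "\<not> ?thesis"
  then have less: "q_fun b v < q_fun b v'" by simp
  then have "v' \<le> v"
    using integral_ramp_antimono[OF b, of "q_fun b v" "q_fun b v'"]
      integral_ramp_q_fun[OF b, of v] integral_ramp_q_fun[OF b, of v'] v by auto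
  then show False using less v by auto
qed

section \<open>The kernels as functions on the square\<close>

text \<open>The value \<open>0\<close> replaces the unspecified \<open>THE\<close> in \<open>q_fun\<close> outside \<open>[0,1]\<close>, which has no known bound.\<close>

definition q_ext :: "real \<Rightarrow> real \<Rightarrow> real" where
  "q_ext b v = (if v \<in> {0<..<1} then q_fun b v else 0)"

definition kern :: "real \<Rightarrow> real \<times> real \<Rightarrow> real" where
  "kern b = (\<lambda>(t, v). ramp b (q_ext b v) t)"

text \<open>Borel representatives of feasible functions, with bounds valid everywhere. The norm
  constraint is left out, since kernels for different \<open>b\<close> are compared with each
  other.\<close>

definition admissible :: "(real \<times> real \<Rightarrow> real) \<Rightarrow> bool" where
  "admissible g \<longleftrightarrow> g \<in> borel_measurable (borel \<Otimes>\<^sub>M borel) \<and> (\<forall>z. 0 \<le> g z \<and> g z \<le> 1) \<and>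
     (AE v in unif. (\<integral>t. g (t, v) \<partial>unif) = v)"

definition sq_norm :: "(real \<times> real \<Rightarrow> real) \<Rightarrow> real" where
  "sq_norm g = (\<integral>z. (g z)\<^sup>2 \<partial>unif2)"

definition lin :: "(real \<times> real \<Rightarrow> real) \<Rightarrow> real" where
  "lin g = (\<integral>(t, v). 2 * (1 - t)\<^sup>2 * g (t, v) \<partial>unif2)"

lemma admissibleD:
  assumes "admissible g"
  shows "g \<in> borel_measurable (borel \<Otimes>\<^sub>M borel)" "\<And>z. 0 \<le> g z" "\<And>z. g z \<le> 1"
    "\<And>z. \<bar>g z\<bar> \<le> 1" "AE v in unif. (\<integral>t. g (t, v) \<partial>unif) = v"
  using assms by (auto simp: admissible_def abs_if intro: order_trans[of _ 0])

lemma q_ext_measurable [measurable]: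
  assumes "b > 0"
  shows "q_ext b \<in> borel_measurable borel"
proof -
  have "mono_on {0<..<1} (\<lambda>v. - q_fun b v)"
    using q_fun_antimono[OF assms] by (auto simp: mono_on_def)
  then have "(\<lambda>v. - q_fun b v) \<in> borel_measurable (restrict_space borel {0<..<1})"
    by (rule borel_measurable_mono_on_fnc)
  then have "(\<lambda>v. - (- q_fun b v)) \<in> borel_measurable (restrict_space borel {0<..<1})"
    by (rule borel_measurable_uminus)
  then have "(\<lambda>v. indicator {0<..<1} v *\<^sub>R q_fun b v) \<in> borel_measurable borel"
    by (subst (asm) borel_measurable_restrict_space_iff) auto
  also have "(\<lambda>v. indicator {0<..<1} v *\<^sub>R q_fun b v) = q_ext b"
    by (auto simp: q_ext_def fun_eq_iff)
  finally show ?thesis .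
qed

lemma abs_q_ext_le:
  assumes "b > 0"
  shows "\<bar>q_ext b v\<bar> \<le> 1 + 1/b"
proof (cases "v \<in> {0<..<1}")
  case True
  then show ?thesis
    using q_fun_mem[OF assms, of v] assms
    by (auto simp: q_ext_def abs_le_iff intro: add_increasing2)
qed (use assms in \<open>auto simp: q_ext_def\<close>)

lemma kern_measurable [measurable]:
  assumes [simp]: "b > 0"
  shows "kern b \<in> borel_measurable (borel \<Otimes>\<^sub>M borel)"
  unfolding kern_def ramp_def clamp_real_def by measurable

lemma integral_kern: "b > 0 \<Longrightarrow> v \<in> {0<..<1} \<Longrightarrow> (\<integral>t. kern b (t, v) \<partial>unif) = v"
  using integral_ramp_q_fun[of b v] by (simp add: kern_def q_ext_def)

lemma admissible_kern: "b > 0 \<Longrightarrow> admissible (kern b)"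
  unfolding admissible_def
  by (intro conjI kern_measurable eventually_mono[OF AE_unif_mem] integral_kern allI)
     (auto simp: kern_def ramp_nonneg ramp_le_1)

lemma kern_eq_h_fun: "v \<in> {0<..<1} \<Longrightarrow> kern b (t, v) = h_fun b t v"
  by (simp add: kern_def h_fun_def ramp_def q_ext_def)

section \<open>Integrability, the marginal constraint and the variational inequality\<close>

lemma AE_unif2_le_1: "AE z in unif2. \<bar>(1 - fst z)\<^sup>2\<bar> \<le> 1 \<and> \<bar>snd z\<bar> \<le> 1"
  using AE_unif2_mem by eventually_elim (auto intro!: power_le_one)

lemma integrable_admissible_mult:
  assumes "admissible g" "\<phi> \<in> borel_measurable (borel \<Otimes>\<^sub>M borel)" "AE z in unif2. \<bar>\<phi> z\<bar> \<le> B"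
  shows "integrable unif2 (\<lambda>z. \<phi> z * g z)"
proof (rule integrable_unif2_bounded)
  show "(\<lambda>z. \<phi> z * g z) \<in> borel_measurable (borel \<Otimes>\<^sub>M borel)"
    using admissibleD(1)[OF assms(1)] assms(2) by measurable
  show "AE z in unif2. \<bar>\<phi> z * g z\<bar> \<le> B"
    using assms(3)
  proof eventually_elim
    case (elim z)
    then have "\<bar>\<phi> z\<bar> * \<bar>g z\<bar> \<le> B * 1"
      using admissibleD(4)[OF assms(1), of z] by (intro mult_mono) auto
    then show ?case by (simp add: abs_mult)
  qed
qed

lemma admissible_integrals:
  assumes "admissible g"
  shows "integrable unif2 g" "integrable unif2 (\<lambda>z. (g z)\<^sup>2)"
    "integrable unif2 (\<lambda>z. 2 * (1 - fst z)\<^sup>2 * g z)"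
proof -
  have [measurable]: "g \<in> borel_measurable (borel \<Otimes>\<^sub>M borel)"
    by (rule admissibleD(1)[OF assms])
  show "integrable unif2 g"
    by (rule integrable_unif2_bounded[of _ 1]) (auto simp: admissibleD(4)[OF assms])
  show "integrable unif2 (\<lambda>z. (g z)\<^sup>2)"
    by (rule integrable_unif2_bounded[of _ 1]) (auto simp: abs_square_le_1 admissibleD(4)[OF assms])
  show "integrable unif2 (\<lambda>z. 2 * (1 - fst z)\<^sup>2 * g z)"
  proof (rule integrable_admissible_mult[OF assms, of _ 2])
    show "AE z in unif2. \<bar>2 * (1 - fst z)\<^sup>2\<bar> \<le> 2"
      using AE_unif2_le_1 by eventually_elim (auto simp: abs_mult)
  qed measurable
qed

lemma integrable_diff_square:
  assumes "admissible g" "admissible h"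
  shows "integrable unif2 (\<lambda>z. (g z - h z)\<^sup>2)"
proof (rule integrable_unif2_bounded[of _ 1])
  have [measurable]: "g \<in> borel_measurable (borel \<Otimes>\<^sub>M borel)" "h \<in> borel_measurable (borel \<Otimes>\<^sub>M borel)"
    using assms by (auto dest: admissibleD)
  show "(\<lambda>z. (g z - h z)\<^sup>2) \<in> borel_measurable (borel \<Otimes>\<^sub>M borel)"
    by measurable
  have "\<bar>g z - h z\<bar> \<le> 1" for z
    using admissibleD(2,3)[OF assms(1), of z] admissibleD(2,3)[OF assms(2), of z] by linarith
  then show "AE z in unif2. \<bar>(g z - h z)\<^sup>2\<bar> \<le> 1"
    by (auto simp: abs_square_le_1)
qed

text \<open>By Fubini, integrating over \<open>t\<close> first replaces \<open>g\<close> by its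
  marginal. The result does not depend on \<open>g\<close>, so a multiplier depending on
  \<open>v\<close> alone cancels between admissible functions.\<close>

lemma admissible_marginal:
  fixes \<phi> :: "real \<Rightarrow> real"
  assumes g: "admissible g" and [measurable]: "\<phi> \<in> borel_measurable borel"
    and B: "AE v in unif. \<bar>\<phi> v\<bar> \<le> B"
  shows "integrable unif2 (\<lambda>z. \<phi> (snd z) * g z)"
    and "(\<integral>z. \<phi> (snd z) * g z \<partial>unif2) = (\<integral>v. \<phi> v * v \<partial>unif)"
proof -
  have [measurable]: "g \<in> borel_measurable (borel \<Otimes>\<^sub>M borel)"
    by (rule admissibleD(1)[OF g])
  have "AE z in unif2. \<bar>\<phi> (snd z)\<bar> \<le> B"
  proof (rule unif2.AE_pair_measure)
    show "{z \<in> space unif2. \<bar>\<phi> (snd z)\<bar> \<le> B} \<in> sets unif2"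
      by measurable
  qed (use B in auto)
  then show int: "integrable unif2 (\<lambda>z. \<phi> (snd z) * g z)"
    by (intro integrable_admissible_mult[OF g]) measurable
  have "(\<integral>z. \<phi> (snd z) * g z \<partial>unif2) = (\<integral>v. \<integral>t. \<phi> v * g (t, v) \<partial>unif \<partial>unif)"
    using unif2.integral_snd[of "\<lambda>t v. \<phi> v * g (t, v)"] int by (simp add: case_prod_unfold)
  also have "\<dots> = (\<integral>v. \<phi> v * v \<partial>unif)"
  proof (rule integral_cong_AE)
    show "AE v in unif. (\<integral>t. \<phi> v * g (t, v) \<partial>unif) = \<phi> v * v"
      using admissibleD(5)[OF g] by eventually_elim simp
  qed measurable
  finally show "(\<integral>z. \<phi> (snd z) * g z \<partial>unif2) = (\<integral>v. \<phi> v * v \<partial>unif)" .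
qed

text \<open>The integral of \<open>ramp_variational\<close> with threshold \<open>q_ext b v\<close>;
  by \<open>admissible_marginal\<close> the threshold terms have equal integrals on both
  sides.\<close>

lemma kern_variational:
  assumes b: "b > 0" and g: "admissible g"
  shows "lin g - sq_norm g / b + (\<integral>z. (kern b z - g z)\<^sup>2 \<partial>unif2) / b
         \<le> lin (kern b) - sq_norm (kern b) / b"
proof -
  note k = admissible_kern[OF b]
  let ?Q = "\<integral>v. q_ext b v * v \<partial>unif"
  note qint = admissible_marginal[where \<phi> = "q_ext b" and B = "1 + 1/b",
      OF _ q_ext_measurable[OF b] AE_I2[OF abs_q_ext_le[OF b]]]
  note ints = admissible_integrals[OF g] admissible_integrals[OF k] qint(1)[OF g] qint(1)[OF k]
    integrable_diff_square[OF k g]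
  have "(\<integral>z. 2 * (1 - fst z)\<^sup>2 * g z - 2 * (q_ext b (snd z) * g z) - (g z)\<^sup>2 / b + (kern b z - g z)\<^sup>2 / b \<partial>unif2)
      \<le> (\<integral>z. 2 * (1 - fst z)\<^sup>2 * kern b z - 2 * (q_ext b (snd z) * kern b z) - (kern b z)\<^sup>2 / b \<partial>unif2)"
  proof (rule integral_mono)
    fix z
    show "2 * (1 - fst z)\<^sup>2 * g z - 2 * (q_ext b (snd z) * g z) - (g z)\<^sup>2 / b + (kern b z - g z)\<^sup>2 / b
      \<le> 2 * (1 - fst z)\<^sup>2 * kern b z - 2 * (q_ext b (snd z) * kern b z) - (kern b z)\<^sup>2 / b"
      using ramp_variational[OF b admissibleD(2,3)[OF g], of "fst z" "q_ext b (snd z)" z]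
      by (simp add: kern_def case_prod_unfold algebra_simps)
  qed (use ints in auto)
  then show ?thesis
    using ints qint(2)[OF g] qint(2)[OF k]
    by (simp add: lin_def sq_norm_def case_prod_unfold)
qed

section \<open>Dependence of the norm on \<open>b\<close>\<close>

text \<open>Each kernel is the competitor in \<open>kern_variational\<close> for the other; on
  addition the \<open>lin\<close> terms cancel, and multiplication by \<open>b * b'\<close> clears
  the denominators.\<close>

lemma sq_norm_kern_dist:
  assumes b: "b > 0" "b' > 0"
  shows "(b + b') * (\<integral>z. (kern b z - kern b' z)\<^sup>2 \<partial>unif2)
         \<le> (b' - b) * (sq_norm (kern b') - sq_norm (kern b))"
proof -
  define D where "D = (\<integral>z. (kern b z - kern b' z)\<^sup>2 \<partial>unif2)"
  have D': "(\<integral>z. (kern b' z - kern b z)\<^sup>2 \<partial>unif2) = D"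
    unfolding D_def by (simp add: power2_commute)
  define x where "x = sq_norm (kern b') - sq_norm (kern b)"
  have "D / b + D / b' \<le> x / b - x / b'"
    using kern_variational[OF b(1) admissible_kern[OF b(2)]]
      kern_variational[OF b(2) admissible_kern[OF b(1)]]
    unfolding D' D_def[symmetric] by (simp add: x_def diff_divide_distrib)
  then have "(D / b + D / b') * (b * b') \<le> (x / b - x / b') * (b * b')"
    using b by (intro mult_right_mono) auto
  then show ?thesis
    using b unfolding D_def[symmetric] x_def[symmetric] by (simp add: algebra_simps)
qed

text \<open>Equal norms force distance zero by \<open>sq_norm_kern_dist\<close>, so the kernels
  agree almost everywhere; one common slice with \<open>0 < v < 1\<close> suffices for
  \<open>ramp_inj\<close>.\<close>

lemma sq_norm_kern_inj:
  assumes b: "b > 0" "b' > 0" and eq: "sq_norm (kern b) = sq_norm (kern b')"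
  shows "b = b'"
proof -
  have "(b + b') * (\<integral>z. (kern b z - kern b' z)\<^sup>2 \<partial>unif2) \<le> 0"
    using sq_norm_kern_dist[OF b] eq by simp
  then have "(\<integral>z. (kern b z - kern b' z)\<^sup>2 \<partial>unif2) \<le> 0"
    using b by (simp add: mult_le_0_iff)
  moreover have "(\<integral>z. (kern b z - kern b' z)\<^sup>2 \<partial>unif2) \<ge> 0"
    by simp
  ultimately have "(\<integral>z. (kern b z - kern b' z)\<^sup>2 \<partial>unif2) = 0" by linarith
  then have ae: "AE z in unif2. kern b z = kern b' z"
    by (subst (asm) integral_nonneg_eq_0_iff_AE)
       (auto intro: integrable_diff_square admissible_kern b)
  have "AE v in unif. v \<in> {0<..<1} \<and> (AE t in unif. kern b (t, v) = kern b' (t, v))"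
    by (rule AE_conjI[OF AE_unif_mem AE_unif2_slices[OF ae]])
  \<comment> \<open>\<open>unif\<close> is not the null measure, so what holds almost everywhere
    holds somewhere.\<close>
  moreover have "ae_filter unif \<noteq> bot"
    by (simp add: ae_filter_eq_bot_iff emeasure_unif)
  ultimately obtain v where "v \<in> {0<..<1}" "AE t in unif. kern b (t, v) = kern b' (t, v)"
    using eventually_happens' by blast
  then show ?thesis
    using ramp_inj(1)[OF b, of "q_ext b v" "q_ext b' v"] integral_kern[OF b(1), of v]
    by (simp add: kern_def)
qed

text \<open>The squared norms differ by \<open>s\<close> with \<open>s\<^sup>2 \<le> 4 * D\<close>,
  where \<open>sq_norm_kern_dist\<close> bounds \<open>D\<close> by a multiple of \<open>s\<close>;
  one factor \<open>\<bar>s\<bar>\<close> then cancels.\<close>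

lemma sq_norm_kern_lipschitz:
  assumes b: "b > 0" "b' > 0"
  shows "(b + b') * \<bar>sq_norm (kern b') - sq_norm (kern b)\<bar> \<le> 4 * \<bar>b' - b\<bar>"
proof -
  note k = admissible_kern[OF b(1)] and k' = admissible_kern[OF b(2)]
  define D where "D = (\<integral>z. (kern b z - kern b' z)\<^sup>2 \<partial>unif2)"
  define s where "s = sq_norm (kern b') - sq_norm (kern b)"
  note ints = admissible_integrals(2)[OF k] admissible_integrals(2)[OF k'] integrable_diff_square[OF k k']
  \<comment> \<open>A pointwise substitute for Cauchy-Schwarz: the weight \<open>s\<close> makes the
    left integral \<open>s\<^sup>2\<close>, which absorbs the term \<open>s\<^sup>2 / 2\<close> on
    the right.\<close>
  have "(\<integral>z. s * ((kern b' z)\<^sup>2 - (kern b z)\<^sup>2) \<partial>unif2)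
      \<le> (\<integral>z. s\<^sup>2 / 2 + 2 * (kern b z - kern b' z)\<^sup>2 \<partial>unif2)"
  proof (rule integral_mono)
    fix z
    let ?d = "kern b' z - kern b z" and ?e = "kern b' z + kern b z"
    have "\<bar>?e\<bar> \<le> 2"
      using admissibleD(4)[OF k, of z] admissibleD(4)[OF k', of z] by linarith
    then have "\<bar>s * ?d\<bar> * \<bar>?e\<bar> \<le> \<bar>s * ?d\<bar> * 2"
      by (intro mult_left_mono) auto
    then have "s * ?d * ?e \<le> 2 * \<bar>s\<bar> * \<bar>?d\<bar>"
      using abs_ge_self[of "s * ?d * ?e"] by (simp add: abs_mult)
    also have "\<dots> \<le> s\<^sup>2 / 2 + 2 * ?d\<^sup>2"
      using zero_le_power2[of "\<bar>s\<bar> - 2 * \<bar>?d\<bar>"] by (simp add: power2_diff power_mult_distrib)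
    finally show "s * ((kern b' z)\<^sup>2 - (kern b z)\<^sup>2) \<le> s\<^sup>2 / 2 + 2 * (kern b z - kern b' z)\<^sup>2"
      by (simp add: algebra_simps power2_eq_square)
  qed (use ints in auto)
  then have "s * s \<le> s\<^sup>2 / 2 + 2 * D"
    using ints by (simp add: s_def D_def sq_norm_def space_pair_measure)
  then have "s\<^sup>2 \<le> 4 * D" by (simp add: power2_eq_square)
  then have "(b + b') * s\<^sup>2 \<le> (b + b') * (4 * D)"
    using b by (intro mult_left_mono) auto
  also have "\<dots> \<le> 4 * ((b' - b) * s)"
    using sq_norm_kern_dist[OF b] by (simp add: s_def D_def)
  also have "\<dots> \<le> 4 * (\<bar>b' - b\<bar> * \<bar>s\<bar>)"
    by (simp flip: abs_mult)
  finally have "((b + b') * \<bar>s\<bar>) * \<bar>s\<bar> \<le> (4 * \<bar>b' - b\<bar>) * \<bar>s\<bar>"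
    by (simp add: power2_eq_square mult.assoc)
  then show ?thesis
    unfolding s_def[symmetric] by (cases "s = 0") (auto simp: mult_le_cancel_right)
qed

lemma continuous_on_sq_norm_kern:
  assumes "a > 0"
  shows "continuous_on {a..} (\<lambda>b. sq_norm (kern b))"
proof -
  \<comment> \<open>On \<open>{a..}\<close> the factor \<open>b + b'\<close> is at least
    \<open>2 * a\<close>, which turns the constant 4 into \<open>2 / a\<close>.\<close>
  have "(2 / a)-lipschitz_on {a..} (\<lambda>b. sq_norm (kern b))"
  proof (rule lipschitz_onI)
    fix b b' assume b: "b \<in> {a..}" "b' \<in> {a..}"
    then have "(2 * a) * \<bar>sq_norm (kern b') - sq_norm (kern b)\<bar> \<le> (b + b') * \<bar>sq_norm (kern b') - sq_norm (kern b)\<bar>"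
      by (intro mult_right_mono) auto
    also have "\<dots> \<le> 4 * \<bar>b' - b\<bar>"
      using b assms by (intro sq_norm_kern_lipschitz) auto
    finally show "dist (sq_norm (kern b)) (sq_norm (kern b')) \<le> 2 / a * dist b b'"
      using assms by (simp add: dist_real_def abs_minus_commute field_simps)
  qed (use assms in auto)
  then show ?thesis by (rule lipschitz_on_continuous_on)
qed

section \<open>Bounds on the norm and existence of \<open>b\<close>\<close>

lemma integral_unif_power: "(\<integral>v. v ^ n \<partial>unif) = 1 / real (Suc n)"
proof -
  have "(\<integral>v. v ^ n \<partial>unif) = (LINT v:{0..1}|lebesgue. v ^ n)"
    by (rule lebesgue_integral_unit_interval[symmetric]) auto
  also have "\<dots> = (\<integral>v. v ^ n * indicator {0..1} v \<partial>lborel)"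
    by (simp add: set_lebesgue_integral_def integral_completion mult.commute)
  also have "\<dots> = 1 / real (Suc n)"
    by (subst integral_power) auto
  finally show ?thesis .
qed

text \<open>For fixed \<open>v\<close> the argument of the clamp varies by at most \<open>b\<close>
  over the unit interval, so the kernel exceeds its mean \<open>v\<close> by at most
  \<open>b\<close>. Its square is thus at most \<open>v + b\<close> times itself, and the integral
  of that product depends on the marginal only.\<close>

lemma sq_norm_kern_upper:
  assumes b: "b > 0"
  shows "sq_norm (kern b) \<le> 1/3 + b/2"
proof -
  note k = admissible_kern[OF b]
  have bound: "AE v in unif. \<bar>v + b\<bar> \<le> 1 + b"
    using AE_unif_mem by eventually_elim (use b in auto)
  note marg = admissible_marginal[OF k _ bound, simplified]
  have "sq_norm (kern b) \<le> (\<integral>z. (snd z + b) * kern b z \<partial>unif2)"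
    unfolding sq_norm_def
  proof (rule integral_mono_AE)
    show "AE z in unif2. (kern b z)\<^sup>2 \<le> (snd z + b) * kern b z"
      using AE_unif2_mem
    proof eventually_elim
      case (elim z)
      obtain t v where z: "z = (t, v)" by (cases z)
      have t: "t \<in> {0<..<1}" and v: "v \<in> {0<..<1}" using elim z by auto
      have "ramp b (q_ext b v) t - b = (\<integral>s. ramp b (q_ext b v) t - b \<partial>unif)"
        by simp
      also have "\<dots> \<le> (\<integral>s. kern b (s, v) \<partial>unif)"
      proof (rule integral_mono_AE)
        show "integrable unif (\<lambda>s. kern b (s, v))"
          unfolding kern_def by (simp add: integrable_ramp)
        show "AE s in unif. ramp b (q_ext b v) t - b \<le> kern b (s, v)"
          using AE_unif_mem
        proof eventually_elim
          case (elim s)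
          then have "(1 - t)\<^sup>2 \<le> 1" "0 \<le> (1 - s)\<^sup>2"
            using t by (auto intro!: power_le_one)
          then have "b * ((1 - t)\<^sup>2 - q_ext b v) \<le> b * (1 + ((1 - s)\<^sup>2 - q_ext b v))"
            using b by (intro mult_left_mono) (auto intro: add_increasing2)
          then have "b * ((1 - t)\<^sup>2 - q_ext b v) - b \<le> b * ((1 - s)\<^sup>2 - q_ext b v)"
            by (simp add: algebra_simps)
          then show ?case
            using b by (auto simp: kern_def ramp_def clamp_real_def)
        qed
      qed simp
      also have "\<dots> = v" by (rule integral_kern[OF b v])
      finally have "kern b z \<le> v + b" by (simp add: z kern_def)
      then have "kern b z * kern b z \<le> (v + b) * kern b z"
        by (intro mult_right_mono admissibleD(2)[OF k])
      then show ?case by (simp add: z power2_eq_square)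
    qed
  qed (use admissible_integrals[OF k] marg in auto)
  also have "\<dots> = (\<integral>v. (v + b) * v \<partial>unif)"
    by (rule marg)
  also have "\<dots> = (\<integral>v. v ^ 2 + b * v ^ 1 \<partial>unif)"
    by (simp add: power2_eq_square algebra_simps)
  also have "\<dots> = (\<integral>v. v ^ 2 \<partial>unif) + b * (\<integral>v. v ^ 1 \<partial>unif)"
  proof -
    have "integrable unif (\<lambda>v::real. v ^ n)" for n
      by (rule unif.integrable_const_bound[of _ 1])
         (auto intro!: eventually_mono[OF AE_unif_mem] power_le_one simp: power_abs)
    from this[of 2] this[of 1] show ?thesis by simp
  qed
  also have "\<dots> = 1/3 + b/2"
    unfolding integral_unif_power by simp
  finally show ?thesis .
qed

text \<open>The kernel has mean 1/2, so the deficit \<open>1/2 - sq_norm (kern b)\<close> is the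
  integral of \<open>k * (1 - k)\<close> with \<open>k = kern b\<close>. For fixed \<open>v\<close>
  this product vanishes outside an interval of length \<open>1 / sqrt b\<close>.\<close>

lemma sq_norm_kern_lower:
  assumes b: "b > 0"
  shows "1/2 - 1 / sqrt b \<le> sq_norm (kern b)"
proof -
  note k = admissible_kern[OF b]
  have [measurable]: "kern b \<in> borel_measurable (borel \<Otimes>\<^sub>M borel)" using b by simp
  have half: "(\<integral>z. kern b z \<partial>unif2) = 1/2"
    using admissible_marginal(2)[OF k, of "\<lambda>_. 1" 1] integral_unif_power[of 1] by simp
  have prod01: "0 \<le> kern b z * (1 - kern b z) \<and> kern b z * (1 - kern b z) \<le> 1" for z
    using admissibleD(2,3)[OF k, of z] by (intro conjI mult_le_one mult_nonneg_nonneg) auto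
  have slice: "(\<integral>t. kern b (t, v) * (1 - kern b (t, v)) \<partial>unif) \<le> 1 / sqrt b" for v
  proof -
    \<comment> \<open>\<open>q_ext b v\<close> may be negative, hence the maximum. Where the kernel
      is strictly between 0 and 1, \<open>1 - t\<close> lies between \<open>r\<close> and
      \<open>r + 1 / sqrt b\<close>, which gives \<open>J\<close>.\<close>
    define r where "r = sqrt (max (q_ext b v) 0)"
    define J where "J = {1 - r - 1 / sqrt b..1 - r}"
    have "(\<integral>t. kern b (t, v) * (1 - kern b (t, v)) \<partial>unif) \<le> (\<integral>t. indicator J t \<partial>unif)"
    proof (rule integral_mono_AE)
      show "integrable unif (\<lambda>t. kern b (t, v) * (1 - kern b (t, v)))"
        by (rule unif.integrable_const_bound[of _ 1])
           (use prod01 in auto)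
      show "integrable unif (indicator J :: real \<Rightarrow> real)"
        by (rule unif.integrable_const_bound[of _ 1]) (auto simp: J_def)
      show "AE t in unif. kern b (t, v) * (1 - kern b (t, v)) \<le> indicator J t"
        using AE_unif_mem
      proof eventually_elim
        case (elim t)
        define k where "k = kern b (t, v)"
        show ?case
        proof (cases "k = 0 \<or> k = 1")
          case True
          then show ?thesis by (auto simp flip: k_def)
        next
          case False
          then have "0 < b * ((1 - t)\<^sup>2 - q_ext b v)" "b * ((1 - t)\<^sup>2 - q_ext b v) < 1"
            by (auto simp: k_def kern_def ramp_def clamp_real_def min_def max_def split: if_splits)
          then have lo: "q_ext b v \<le> (1 - t)\<^sup>2" and hi: "(1 - t)\<^sup>2 \<le> q_ext b v + 1 / b"
            using b by (auto simp: zero_less_mult_iff field_simps)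
          have "r \<le> 1 - t"
            unfolding r_def using lo elim by (intro real_le_lsqrt) auto
          moreover have "(1 - t)\<^sup>2 \<le> (r + 1 / sqrt b)\<^sup>2"
          proof -
            have "(1 - t)\<^sup>2 \<le> r\<^sup>2 + (1 / sqrt b)\<^sup>2"
              using hi b by (simp add: r_def power_divide)
            also have "\<dots> \<le> (r + 1 / sqrt b)\<^sup>2"
              using b by (simp add: power2_sum r_def)
            finally show ?thesis .
          qed
          then have "1 - t \<le> r + 1 / sqrt b"
            by (rule power2_le_imp_le) (use b in \<open>auto simp: r_def\<close>)
          ultimately have "t \<in> J" by (simp add: J_def)
          moreover have "k * (1 - k) \<le> 1" using prod01 by (simp add: k_def)
          ultimately show ?thesis by (simp flip: k_def)
        qed
      qed
    qed
    also have "\<dots> = measure unif J" by (simp add: J_def)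
    also have "\<dots> \<le> 1 / sqrt b"
    proof -
      have "emeasure unif J \<le> emeasure lborel J"
        by (subst emeasure_unif) (auto simp: J_def intro: emeasure_mono)
      also have "\<dots> = ennreal (1 / sqrt b)"
        using b by (simp add: J_def)
      finally show ?thesis
        using b by (simp add: measure_def enn2real_leI)
    qed
    finally show ?thesis .
  qed
  have int: "integrable unif2 (\<lambda>z. kern b z * (1 - kern b z))"
    using admissible_integrals[OF k] by (simp add: algebra_simps power2_eq_square)
  have "1/2 - sq_norm (kern b) = (\<integral>z. kern b z * (1 - kern b z) \<partial>unif2)"
    using admissible_integrals[OF k] by (simp add: sq_norm_def half algebra_simps power2_eq_square)
  also have "\<dots> = (\<integral>v. \<integral>t. kern b (t, v) * (1 - kern b (t, v)) \<partial>unif \<partial>unif)"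
    using unif2.integral_snd[of "\<lambda>t v. kern b (t, v) * (1 - kern b (t, v))"] int
    by (simp add: case_prod_unfold)
  also have "\<dots> \<le> (\<integral>v. 1 / sqrt b \<partial>unif)"
    using unif2.integrable_snd[of "\<lambda>t v. kern b (t, v) * (1 - kern b (t, v))"] int slice
    by (intro integral_mono) (auto simp: case_prod_unfold)
  finally show ?thesis by simp
qed

lemma ex_sq_norm_kern:
  assumes c: "c \<in> {0<..<1}"
  shows "\<exists>b>0. 6 * sq_norm (kern b) - 2 = c"
proof -
  \<comment> \<open>Endpoints for the intermediate value theorem:
    \<open>6 * sq_norm (kern b) - 2\<close> is at most \<open>3 * a = c / 2\<close> at
    \<open>a\<close> by the upper bound, and at least \<open>c\<close> at \<open>d\<close> by the
    lower bound.\<close>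
  define a where "a = c / 6"
  define d where "d = (6 / (1 - c))\<^sup>2"
  have a: "0 < a" "a \<le> 1" using c by (auto simp: a_def)
  have "1 \<le> 6 / (1 - c)" using c by (simp add: field_simps)
  then have "1\<^sup>2 \<le> d" unfolding d_def by (intro power_mono) auto
  then have d: "1 \<le> d" by simp
  have "sqrt d = 6 / (1 - c)" using c by (simp add: d_def real_sqrt_abs)
  then have "1 / sqrt d = (1 - c) / 6" by simp
  then have hi: "c \<le> 6 * sq_norm (kern d) - 2"
    using sq_norm_kern_lower[of d] d by simp
  have lo: "6 * sq_norm (kern a) - 2 \<le> c"
    using sq_norm_kern_upper[OF a(1)] c by (simp add: a_def)
  have "continuous_on {a..d} (\<lambda>b. 6 * sq_norm (kern b) - 2)"
    by (intro continuous_intros continuous_on_subset[OF continuous_on_sq_norm_kern[OF a(1)]]) auto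
  then obtain b where "a \<le> b" "6 * sq_norm (kern b) - 2 = c"
    using IVT'[of "\<lambda>b. 6 * sq_norm (kern b) - 2" a c d] lo hi a d by auto
  then show ?thesis using a by (intro exI[of _ b]) auto
qed

section \<open>The rank correlation and the optimization problem\<close>

text \<open>The fundamental theorem of calculus, as \<open>h_fun\<close> is continuous in
  \<open>t\<close> for every \<open>v\<close>. Inside the square, \<open>deriv\<close> in
  \<open>chatterjee_xi\<close> is therefore never unspecified.\<close>

lemma C_fun_has_derivative:
  assumes t: "t \<in> {0<..<1}"
  shows "((\<lambda>s. C_fun b s v) has_real_derivative h_fun b t v) (at t)"
proof -
  define f where "f = ramp b (q_fun b v)"
  have f: "h_fun b s v = f s" for s
    by (simp add: f_def h_fun_def ramp_def)
  have cont: "continuous_on A f" for A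
    unfolding f_def by (intro continuous_intros)
  \<comment> \<open>The Lebesgue integral becomes a Henstock-Kurzweil integral, for which that
    theorem is stated.\<close>
  have C: "C_fun b u v = integral {0..u} f" for u
  proof -
    have "set_integrable lborel {0..u} f"
      using borel_integrable_atLeastAtMost'[OF cont] by (simp add: set_integrable_def)
    then have "set_integrable lebesgue {0..u} f"
      by (simp add: set_integrable_def integrable_completion borel_measurable_integrable)
    then show ?thesis
      unfolding C_fun_def f by (rule set_lebesgue_integral_eq_integral)
  qed
  have "((\<lambda>u. integral {0..u} f) has_real_derivative f t) (at t within {0..1})"
    using t by (intro integral_has_real_derivative cont) auto
  then have "((\<lambda>u. integral {0..u} f) has_real_derivative f t) (at t)"
    using t by (subst (asm) at_within_interior) auto
  then show ?thesis by (simp add: C f)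
qed

lemma chatterjee_xi_C_fun:
  assumes b: "b > 0"
  shows "chatterjee_xi (C_fun b) = 6 * sq_norm (kern b) - 2"
proof -
  have "AE (t, v) in unif2. (deriv (\<lambda>s. C_fun b s v) t)\<^sup>2 = (kern b (t, v))\<^sup>2"
    using AE_unif2_mem
    by eventually_elim (auto simp: kern_eq_h_fun DERIV_imp_deriv[OF C_fun_has_derivative])
  from lebesgue_iterated_unit_square(2)[OF admissible_integrals(2)[OF admissible_kern[OF b]] this, of "{0..1}"]
  show ?thesis
    by (simp add: chatterjee_xi_def sq_norm_def)
qed

lemma objective_eq_lin:
  assumes g: "admissible g" and ae: "AE (t, v) in unif2. h t v = g (t, v)"
  shows "objective h = lin g"
proof -
  have "AE (t, v) in unif2. 2 * (1 - t)\<^sup>2 * h t v = 2 * (1 - fst (t, v))\<^sup>2 * g (t, v)"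
    using ae by eventually_elim auto
  from lebesgue_iterated_unit_square(2)[OF admissible_integrals(3)[OF g] this, of "{0<..<1}"]
  show ?thesis
    by (simp add: objective_def lin_def case_prod_unfold)
qed

lemma integral_square_eq_sq_norm:
  assumes g: "admissible g" and ae: "AE (t, v) in unif2. h t v = g (t, v)"
  shows "(LINT v:{0<..<1}|lebesgue. LINT t:{0<..<1}|lebesgue. (h t v)\<^sup>2) = sq_norm g"
proof -
  have "AE (t, v) in unif2. (h t v)\<^sup>2 = (g (t, v))\<^sup>2"
    using ae by eventually_elim auto
  from lebesgue_iterated_unit_square(2)[OF admissible_integrals(2)[OF g] this, of "{0<..<1}"]
  show ?thesis by (simp add: sq_norm_def)
qed

section \<open>Feasible functions and the optimizer\<close>

lemma AE_lebesgue_on_unit_interval: "(AE v in lebesgue_on {0<..<1}. P v) \<longleftrightarrow> (AE v in unif. P v)"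
  unfolding AE_unif_iff by (subst AE_restrict_space_iff) (auto simp: AE_completion_iff)

text \<open>A Lebesgue measurable function agrees almost everywhere with a Borel one. Clamping the
  latter to \<open>[0,1]\<close> changes it only on a null subset of the square, since
  \<open>h\<close> satisfies the bounds almost everywhere; the marginal constraint transfers by
  slices.\<close>

lemma feasible_representative:
  assumes "feasible c h"
  obtains g where "admissible g" "AE (t, v) in unif2. h t v = g (t, v)"
proof -
  have "(\<lambda>(t, v). h t v) \<in> borel_measurable (lebesgue_on unit_square)"
    using assms by (simp add: feasible_def L2_square_def)
  then have "(\<lambda>z. indicator unit_square z *\<^sub>R (case z of (t, v) \<Rightarrow> h t v)) \<in> borel_measurable lebesgue"
    by (subst (asm) borel_measurable_restrict_space_iff) auto
  then obtain g0 where g0: "g0 \<in> borel_measurable lborel"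
    "AE z in lborel. indicator unit_square z *\<^sub>R (case z of (t, v) \<Rightarrow> h t v) = g0 z"
    using completion_ex_borel_measurable_real by blast
  have "g0 \<in> borel_measurable (borel \<Otimes>\<^sub>M borel)"
    using g0(1) by (simp add: borel_prod)
  note [measurable] = this
  define g where "g = (\<lambda>z. min (max (g0 z) 0) 1)"
  have [measurable]: "g \<in> borel_measurable (borel \<Otimes>\<^sub>M borel)"
    unfolding g_def by measurable
  have g01: "0 \<le> g z \<and> g z \<le> 1" for z by (auto simp: g_def)
  have "AE z in unif2. indicator unit_square z *\<^sub>R (case z of (t, v) \<Rightarrow> h t v) = g0 z"
    unfolding AE_unif2_iff
    using AE_completion[OF g0(2)] by (subst AE_restrict_space_iff) auto
  moreover have "AE z in unif2. case z of (t, v) \<Rightarrow> 0 \<le> h t v \<and> h t v \<le> 1"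
    using assms by (simp add: feasible_def AE_unif2_iff)
  ultimately have ae: "AE (t, v) in unif2. h t v = g (t, v)"
    using AE_unif2_mem
    by eventually_elim (auto simp: g_def indicator_def min_def max_def split: if_splits)
  have int: "integrable unif2 g"
    by (rule integrable_unif2_bounded[of _ 1]) (use g01 in \<open>auto simp: abs_le_iff intro: order_trans[of _ 0]\<close>)
  have "AE v in unif. (LINT t:{0<..<1}|lebesgue. h t v) = v"
    using assms by (simp add: feasible_def AE_lebesgue_on_unit_interval)
  moreover have "AE v in unif. (LINT t:{0<..<1}|lebesgue. h t v) = (\<integral>t. g (t, v) \<partial>unif)"
    by (rule lebesgue_iterated_unit_square(1)[OF int ae]) simp
  ultimately have "AE v in unif. (\<integral>t. g (t, v) \<partial>unif) = v"
    by eventually_elim simp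
  then have "admissible g"
    unfolding admissible_def using g01 by auto
  then show ?thesis using that ae by blast
qed

lemma AE_h_fun_eq_kern: "AE (t, v) in unif2. h_fun b t v = kern b (t, v)"
  using AE_unif2_mem by eventually_elim (auto simp: kern_eq_h_fun)

text \<open>On the open square \<open>h_fun\<close> coincides with the Borel function
  \<open>kern\<close>, which supplies measurability, marginals and norm; square integrability
  follows from boundedness and finite measure.\<close>

lemma feasible_h_fun:
  assumes b: "b > 0" and c: "6 * sq_norm (kern b) - 2 \<le> c"
  shows "feasible c (h_fun b)"
proof -
  note k = admissible_kern[OF b]
  have "kern b \<in> borel_measurable borel"
    using kern_measurable[OF b] by (simp add: borel_prod)
  then have kl: "kern b \<in> borel_measurable (lebesgue_on unit_square)"
    by (intro measurable_restrict_space1 measurable_completion) simp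
  have eq: "(case z of (t, v) \<Rightarrow> h_fun b t v) = kern b z" if "z \<in> space (lebesgue_on unit_square)" for z
    using that by (auto simp: kern_eq_h_fun space_restrict_space)
  have m: "(\<lambda>(t, v). h_fun b t v) \<in> borel_measurable (lebesgue_on unit_square)"
    using kl by (subst measurable_cong[OF eq]) auto
  have h01: "0 \<le> h_fun b t v \<and> h_fun b t v \<le> 1" for t v
    by (auto simp: h_fun_def clamp_real_def)
  have "emeasure lborel unit_square = emeasure (lborel \<Otimes>\<^sub>M lborel) unit_square"
    by (simp add: lborel_prod)
  also have "\<dots> = 1"
    by (subst lborel.emeasure_pair_measure_Times) auto
  finally have "emeasure lebesgue unit_square < \<infinity>"
    by simp
  then interpret fin: finite_measure "lebesgue_on unit_square"
    by (intro finite_measureI) (simp add: emeasure_restrict_space space_restrict_space less_top)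
  have "integrable (lebesgue_on unit_square) (\<lambda>z. (case z of (t, v) \<Rightarrow> h_fun b t v)\<^sup>2)"
  proof (rule fin.integrable_const_bound[of _ 1])
    show "(\<lambda>z. (case z of (t, v) \<Rightarrow> h_fun b t v)\<^sup>2) \<in> borel_measurable (lebesgue_on unit_square)"
      using m by (rule borel_measurable_power)
  qed (use h01 in \<open>auto simp: abs_square_le_1\<close>)
  then have "h_fun b \<in> L2_square"
    using m by (simp add: L2_square_def case_prod_unfold)
  moreover have "AE v in lebesgue_on {0<..<1}. (LINT t:{0<..<1}|lebesgue. h_fun b t v) = v"
  proof -
    have "AE v in unif. (LINT t:{0<..<1}|lebesgue. h_fun b t v) = (\<integral>t. kern b (t, v) \<partial>unif)"
      by (rule lebesgue_iterated_unit_square(1)[OF admissible_integrals(1)[OF k] AE_h_fun_eq_kern]) simp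
    then show ?thesis
      unfolding AE_lebesgue_on_unit_interval
      using admissibleD(5)[OF k] by eventually_elim simp
  qed
  ultimately show ?thesis
    using c h01 integral_square_eq_sq_norm[OF k AE_h_fun_eq_kern]
    by (simp add: feasible_def)
qed

lemma objective_gap:
  assumes b: "b > 0" and h: "feasible (6 * sq_norm (kern b) - 2) h"
    and g: "admissible g" and ae: "AE (t, v) in unif2. h t v = g (t, v)"
  shows "objective h + (\<integral>z. (kern b z - g z)\<^sup>2 \<partial>unif2) / b \<le> objective (h_fun b)"
proof -
  have "sq_norm g \<le> sq_norm (kern b)"
    using h integral_square_eq_sq_norm[OF g ae] by (simp add: feasible_def)
  then have "sq_norm g / b \<le> sq_norm (kern b) / b"
    using b by (intro divide_right_mono) auto
  then show ?thesis
    using kern_variational[OF b g] objective_eq_lin[OF g ae]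
      objective_eq_lin[OF admissible_kern[OF b] AE_h_fun_eq_kern] by linarith
qed

lemma h_fun_unique_optimizer:
  assumes b: "b > 0" and c: "c = 6 * sq_norm (kern b) - 2"
  shows "is_arg_max objective (feasible c) (h_fun b)"
    and "is_arg_max objective (feasible c) h \<Longrightarrow> L2_eq h (h_fun b)"
proof -
  have feas: "feasible c (h_fun b)"
    using feasible_h_fun[OF b] c by simp
  have "objective h \<le> objective (h_fun b)" if "feasible c h" for h
  proof -
    obtain g where g: "admissible g" "AE (t, v) in unif2. h t v = g (t, v)"
      using feasible_representative[OF \<open>feasible c h\<close>] by blast
    have "0 \<le> (\<integral>z. (kern b z - g z)\<^sup>2 \<partial>unif2) / b"
      using b by simp
    then show ?thesis
      using objective_gap[OF b that[unfolded c] g] by linarith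
  qed
  with feas show "is_arg_max objective (feasible c) (h_fun b)"
    by (auto simp: is_arg_max_def not_less)
  assume opt: "is_arg_max objective (feasible c) h"
  then have h: "feasible c h" and ge: "objective (h_fun b) \<le> objective h"
    using feas by (auto simp: is_arg_max_def not_less)
  obtain g where g: "admissible g" and ae: "AE (t, v) in unif2. h t v = g (t, v)"
    using feasible_representative[OF h] by blast
  \<comment> \<open>An optimizer leaves no room for the gap, so its distance from
    \<open>kern b\<close> is zero.\<close>
  have "(\<integral>z. (kern b z - g z)\<^sup>2 \<partial>unif2) / b \<le> 0"
    using objective_gap[OF b h[unfolded c] g ae] ge by linarith
  then have "(\<integral>z. (kern b z - g z)\<^sup>2 \<partial>unif2) \<le> 0"
    using b by (simp add: divide_le_0_iff)
  moreover have "0 \<le> (\<integral>z. (kern b z - g z)\<^sup>2 \<partial>unif2)" by simp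
  ultimately have "(\<integral>z. (kern b z - g z)\<^sup>2 \<partial>unif2) = 0" by linarith
  then have "AE z in unif2. kern b z = g z"
    by (subst (asm) integral_nonneg_eq_0_iff_AE)
       (auto intro: integrable_diff_square admissible_kern b g)
  then have "AE (t, v) in unif2. h t v = h_fun b t v"
    using ae AE_h_fun_eq_kern[of b] by eventually_elim auto
  then show "L2_eq h (h_fun b)"
    by (simp add: L2_eq_def AE_unif2_iff)
qed

theorem theorem3p4:
  fixes c :: real
  assumes "c \<in> {0<..<1}"
  shows "(\<exists>!b. b > 0 \<and> chatterjee_xi (C_fun b) = c) \<and>
         (\<forall>b>0. chatterjee_xi (C_fun b) = c \<longrightarrow>
            is_arg_max objective (feasible c) (h_fun b) \<and>
            (\<forall>h. is_arg_max objective (feasible c) h \<longrightarrow> L2_eq h (h_fun b)))"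
proof (intro conjI allI impI)
  obtain b where b: "b > 0" "6 * sq_norm (kern b) - 2 = c"
    using ex_sq_norm_kern[OF assms] by blast
  show "\<exists>!b. b > 0 \<and> chatterjee_xi (C_fun b) = c"
  proof (rule ex1I[of _ b])
    show "b > 0 \<and> chatterjee_xi (C_fun b) = c"
      using b by (simp add: chatterjee_xi_C_fun)
    fix b' assume b': "b' > 0 \<and> chatterjee_xi (C_fun b') = c"
    then have "sq_norm (kern b') = sq_norm (kern b)"
      using b(2) chatterjee_xi_C_fun[of b'] by linarith
    then show "b' = b"
      using b' b(1) sq_norm_kern_inj by blast
  qed
next
  fix b :: real assume "b > 0" "chatterjee_xi (C_fun b) = c"
  then show "is_arg_max objective (feasible c) (h_fun b)"
    using chatterjee_xi_C_fun[of b] h_fun_unique_optimizer(1)[of b c] by argo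
next
  fix b :: real and h
  assume "b > 0" "chatterjee_xi (C_fun b) = c" "is_arg_max objective (feasible c) h"
  then show "L2_eq h (h_fun b)"
    using chatterjee_xi_C_fun[of b] h_fun_unique_optimizer(2)[of b c h] by argo
qed

end
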